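(* Let $G$ be an infinite countable discrete amenable group with a F\o lner sequence $\mathbf{F}$, and let $(X,G)$ be a $G$-system. If $(X,G)$ is strongly mixing, then the following properties hold: (1) for each admissible open cover $\mathcal{U}$ of $X$ and any infinite subset $H$ of $G$, there exists an infinite subset $S\subset H$ such that $h_{\mathrm{top}}^{S,\mathbf{F}}(G,\mathcal{U})=\log\mathcal{N}(\mathcal{U})$; (2) for each non-trivial finite open cover $\mathcal{U}$ of $X$ and any infinite subset $H$ of $G$, there exists an infinite subset $S\subset H$ such that $h_{\mathrm{top}}^{S,\mathbf{F}}(G,\mathcal{U})>0$.
   Context: The F\o lner sequence $\mathbf{F}=\{F_n\}_{n=1}^\infty$ is a sequence of finite subsets of $G$ with $\lim_{n\to\infty}|gF_n\triangle F_n|/|F_n|=0$ for every $g\in G$, $e_G\in F_1\subseteq F_2\subseteq\cdots$ and $\bigcup_n F_n=G$. A $G$-system $(X,G)$ is a compact metric space $X$ with a continuous action of $G$. The system $(X,G)$ is strongly (topologically) mixing if for every two nonempty open subsets $U,V$ of $X$ the set $\{g\in G:U\cap g^{-1}V=\emptyset\}$ is finite. An open cover $\mathcal{U}=\{U_1,\ldots,U_n\}$ of $X$ is non-trivial if no $U_i$ is dense in $X$. An open cover $\{U_i\}_{i\in I}$ is admissible if $U_i\setminus\bigcup_{j\in I,j\neq i}U_j$ has nonempty interior for each $i\in I$ (such a cover of a compact space is necessarily finite). For a finite open cover $\mathcal{U}$, $\mathcal{N}(\mathcal{U})$ is the minimal cardinality of a subcover, $g^{-1}\mathcal{U}=\{g^{-1}U:U\in\mathcal{U}\}$,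 and $\bigvee$ denotes the common refinement. For an infinite subset $S\subset G$, $$h_{\mathrm{top}}^{S,\mathbf{F}}(G,\mathcal{U})=\limsup_{n\to\infty}\frac{1}{|S\cap F_n|}\log\mathcal{N}\Big(\bigvee_{g\in S\cap F_n}g^{-1}\mathcal{U}\Big).$$ *)

theory Defs
  imports "HOL-Analysis.Analysis" "HOL-Algebra.Group_Action"
begin

definition asymptotically_invariant :: "('g, 'b) monoid_scheme \<Rightarrow> (nat \<Rightarrow> 'g set) \<Rightarrow> bool" where
  "asymptotically_invariant G F \<longleftrightarrow>
     (\<forall>n\<ge>1. finite (F n) \<and> F n \<noteq> {} \<and> F n \<subseteq> carrier G) \<and>
     (\<forall>g\<in>carrier G.
        (\<lambda>n. real (card (sym_diff (g <#\<^bsub>G\<^esub> F n) (F n))) / real (card (F n))) \<longlonglongrightarrow> 0)"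

text \<open>Amenability of a countable discrete group, by F\o lner's criterion.\<close>

definition amenable_group :: "('g, 'b) monoid_scheme \<Rightarrow> bool" where
  "amenable_group G \<longleftrightarrow> group G \<and> (\<exists>F. asymptotically_invariant G F)"

text \<open>Sequences are indexed by \<open>n \<ge> 1\<close>; the value \<open>F 0\<close> is unconstrained.\<close>

definition Folner_sequence :: "('g, 'b) monoid_scheme \<Rightarrow> (nat \<Rightarrow> 'g set) \<Rightarrow> bool" where
  "Folner_sequence G F \<longleftrightarrow>
     asymptotically_invariant G F \<and>
     \<one>\<^bsub>G\<^esub> \<in> F 1 \<and> (\<forall>n\<ge>1. F n \<subseteq> F (Suc n)) \<and> (\<Union>n\<in>{1..}. F n) = carrier G"

text \<open>As \<open>G\<close> is discrete, the action is continuous iff every \<open>\<phi> g\<close> is.\<close>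

definition G_system ::
  "('g, 'b) monoid_scheme \<Rightarrow> 'x set \<Rightarrow> ('x \<Rightarrow> 'x \<Rightarrow> real) \<Rightarrow> ('g \<Rightarrow> 'x \<Rightarrow> 'x) \<Rightarrow> bool" where
  "G_system G X d \<phi> \<longleftrightarrow>
     Metric_space X d \<and> compact_space (Metric_space.mtopology X d) \<and>
     group_action G X \<phi> \<and>
     (\<forall>g\<in>carrier G.
        continuous_map (Metric_space.mtopology X d) (Metric_space.mtopology X d) (\<phi> g))"

definition translate_inv ::
  "('g, 'b) monoid_scheme \<Rightarrow> ('g \<Rightarrow> 'x \<Rightarrow> 'x) \<Rightarrow> 'g \<Rightarrow> 'x set \<Rightarrow> 'x set" where
  "translate_inv G \<phi> g V = \<phi> (inv\<^bsub>G\<^esub> g) ` V"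

definition strongly_mixing ::
  "('g, 'b) monoid_scheme \<Rightarrow> 'x topology \<Rightarrow> ('g \<Rightarrow> 'x \<Rightarrow> 'x) \<Rightarrow> bool" where
  "strongly_mixing G T \<phi> \<longleftrightarrow>
     (\<forall>U V. openin T U \<and> openin T V \<and> U \<noteq> {} \<and> V \<noteq> {} \<longrightarrow>
        finite {g \<in> carrier G. U \<inter> translate_inv G \<phi> g V = {}})"

definition open_cover :: "'x topology \<Rightarrow> 'x set set \<Rightarrow> bool" where
  "open_cover T \<U> \<longleftrightarrow> (\<forall>U\<in>\<U>. openin T U) \<and> \<Union>\<U> = topspace T"

text \<open>The condition \<open>\<U> \<noteq> {}\<close> expresses that a cover \<open>{U\<^sub>1, \<dots>, U\<^sub>n}\<close> has \<open>n \<ge> 1\<close>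
  members; it matters only for the empty space.\<close>

definition nontrivial_finite_open_cover :: "'x topology \<Rightarrow> 'x set set \<Rightarrow> bool" where
  "nontrivial_finite_open_cover T \<U> \<longleftrightarrow>
     open_cover T \<U> \<and> finite \<U> \<and> \<U> \<noteq> {} \<and> (\<forall>U\<in>\<U>. T closure_of U \<noteq> topspace T)"

text \<open>The members of an admissible indexed family are pairwise distinct, so nothing is lost
  by taking covers to be sets of sets.\<close>

definition admissible_open_cover :: "'x topology \<Rightarrow> 'x set set \<Rightarrow> bool" where
  "admissible_open_cover T \<U> \<longleftrightarrow>
     open_cover T \<U> \<and> (\<forall>U\<in>\<U>. T interior_of (U - \<Union>(\<U> - {U})) \<noteq> {})"

definition min_subcover_card :: "'x set \<Rightarrow> 'x set set \<Rightarrow> nat" where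
  "min_subcover_card X \<U> = (LEAST n. \<exists>\<V>\<subseteq>\<U>. finite \<V> \<and> card \<V> = n \<and> X \<subseteq> \<Union>\<V>)"

text \<open>The common refinement of the covers \<open>\<C> i\<close>, \<open>i \<in> I\<close>; it is \<open>{X}\<close> if \<open>I = {}\<close>.\<close>

definition cover_join :: "'x set \<Rightarrow> 'i set \<Rightarrow> ('i \<Rightarrow> 'x set set) \<Rightarrow> 'x set set" where
  "cover_join X I \<C> = {X \<inter> (\<Inter>i\<in>I. f i) | f. \<forall>i\<in>I. f i \<in> \<C> i}"

text \<open>The finitely many \<open>n\<close> with \<open>S \<inter> F n = {}\<close>, where the quotient is not meaningful,
  do not affect the limit superior.\<close>

definition seq_top_entropy ::
  "('g, 'b) monoid_scheme \<Rightarrow> 'x set \<Rightarrow> ('g \<Rightarrow> 'x \<Rightarrow> 'x) \<Rightarrow> (nat \<Rightarrow> 'g set) \<Rightarrow> 'g set \<Rightarrow>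
     'x set set \<Rightarrow> ereal" where
  "seq_top_entropy G X \<phi> F S \<U> =
     limsup (\<lambda>n. ereal (1 / real (card (S \<inter> F n)) *
       ln (real (min_subcover_card X
         (cover_join X (S \<inter> F n) (\<lambda>g. translate_inv G \<phi> g ` \<U>))))))"

end

theory Submission
  imports Defs
begin

text \<open>Attach to each member \<open>U\<close> of the cover a nonempty open set \<open>W U\<close>. By mixing one can choose
  the elements of \<open>S \<subseteq> H\<close> one at a time so that for every finite \<open>A \<subseteq> S\<close> every word \<open>w : A \<rightarrow> \<U>\<close> is
  realised by a point whose \<open>g\<close>-translate lies in \<open>W (w g)\<close> for all \<open>g \<in> A\<close>. If each member of \<open>\<U>\<close>
  meets at most \<open>c\<close> of the sets \<open>W U\<close>, then a member of the join over \<open>A\<close> contains at most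
  \<open>c\<^bsup>|A|\<^esup>\<close> of these \<open>|\<U>|\<^bsup>|A|\<^esup>\<close> points, so the entropy along \<open>S\<close> is at least
  \<open>log |\<U>| - log c\<close>. For an admissible cover take the interior of \<open>U\<close> minus the other members,
  with \<open>c = 1\<close>; for a non-trivial cover take the complement of the closure of \<open>U\<close>, with
  \<open>c = |\<U>| - 1\<close>.\<close>

section \<open>Independence of families of open sets along subsets of the group\<close>

definition independent_along ::
  "'x set \<Rightarrow> ('g \<Rightarrow> 'x \<Rightarrow> 'x) \<Rightarrow> ('u \<Rightarrow> 'x set) \<Rightarrow> 'u set \<Rightarrow> 'g set \<Rightarrow> bool" where
  "independent_along X \<phi> W \<U> A \<longleftrightarrow> (\<forall>w\<in>A \<rightarrow> \<U>. \<exists>x\<in>X. \<forall>g\<in>A. \<phi> g x \<in> W (w g))"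

text \<open>Greedy construction: repeated extension yields an increasing chain of finite sets with
  \<open>card (f n) = n\<close>, which makes the union infinite. A finite subset of the union
  already lies in one member of the chain, so \<open>mono\<close> gives it \<open>P\<close>.\<close>

lemma infinite_set_from_finite_extensions:
  assumes empty: "P {}"
    and step: "\<And>A. finite A \<Longrightarrow> A \<subseteq> H \<Longrightarrow> P A \<Longrightarrow> \<exists>g\<in>H - A. P (insert g A)"
    and mono: "\<And>A B. P B \<Longrightarrow> A \<subseteq> B \<Longrightarrow> P A"
  shows "\<exists>S\<subseteq>H. infinite S \<and> (\<forall>A\<subseteq>S. finite A \<longrightarrow> P A)"
proof -
  have "\<exists>f. \<forall>n. (finite (f n) \<and> f n \<subseteq> H \<and> P (f n) \<and> card (f n) = n) \<and> f n \<subseteq> f (Suc n)"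
  proof (rule dependent_nat_choice)
    show "\<exists>A. finite A \<and> A \<subseteq> H \<and> P A \<and> card A = 0"
      using empty by (intro exI[of _ "{}"]) auto
  next
    fix A n
    assume A: "finite A \<and> A \<subseteq> H \<and> P A \<and> card A = n"
    then obtain g where "g \<in> H - A" "P (insert g A)"
      using step by blast
    then show "\<exists>B. (finite B \<and> B \<subseteq> H \<and> P B \<and> card B = Suc n) \<and> A \<subseteq> B"
      using A by (intro exI[of _ "insert g A"]) auto
  qed
  then obtain f where f: "\<And>n. finite (f n)" "\<And>n. f n \<subseteq> H" "\<And>n. P (f n)" "\<And>n. card (f n) = n"
    and "\<And>n. f n \<subseteq> f (Suc n)"
    by auto
  then have "incseq f"
    by (simp add: incseq_Suc_iff)
  show ?thesis
  proof (intro exI conjI allI impI)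
    show "(\<Union>n. f n) \<subseteq> H"
      using f(2) by blast
    show "infinite (\<Union>n. f n)"
    proof
      assume fin: "finite (\<Union>n. f n)"
      have "card (f (Suc (card (\<Union>n. f n)))) \<le> card (\<Union>n. f n)"
        by (rule card_mono[OF fin]) blast
      then show False
        by (simp add: f(4))
    qed
    fix A assume "A \<subseteq> (\<Union>n. f n)" "finite A"
    then have "\<forall>a\<in>A. \<exists>n. a \<in> f n"
      by blast
    then obtain N where N: "\<And>a. a \<in> A \<Longrightarrow> a \<in> f (N a)"
      by metis
    \<comment> \<open>The sum of the indices serves as a common upper bound for them, and it also
      makes sense for empty \<open>A\<close>.\<close>
    have "A \<subseteq> f (sum N A)"
    proof
      fix a assume "a \<in> A"
      then have "N a \<le> sum N A"
        using \<open>finite A\<close> by (intro member_le_sum) auto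
      then show "a \<in> f (sum N A)"
        using N[OF \<open>a \<in> A\<close>] incseqD[OF \<open>incseq f\<close>] by blast
    qed
    then show "P A"
      using f(3) mono by blast
  qed
qed

text \<open>\<open>\<phi> g\<close> and \<open>\<phi> (inv g)\<close> are mutually inverse on
  \<open>X\<close>, so the image under one is the preimage under the other. The preimage form gives
  openness by continuity and lets membership be read off as a condition on
  \<open>\<phi> g x\<close>.\<close>

lemma translate_inv_eq_vimage:
  assumes act: "group_action G X \<phi>" and g: "g \<in> carrier G" and V: "V \<subseteq> X"
  shows "translate_inv G \<phi> g V = {x \<in> X. \<phi> g x \<in> V}"
proof -
  interpret group_action G X \<phi> by (rule act)
  interpret group G
    using group_hom by (simp add: group_hom_def)
  have "\<phi> (inv\<^bsub>G\<^esub> g) y \<in> X \<and> \<phi> g (\<phi> (inv\<^bsub>G\<^esub> g) y) = y" if "y \<in> X" for y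
    using element_image[OF inv_closed[OF g] that] orbit_sym_aux[OF inv_closed[OF g] that] g by simp
  moreover have "\<phi> (inv\<^bsub>G\<^esub> g) (\<phi> g x) = x" if "x \<in> X" for x
    using orbit_sym_aux[OF g that] by simp
  ultimately show ?thesis
    using V unfolding translate_inv_def by (force simp: image_iff)
qed

text \<open>The points realising a word \<open>w\<close> on \<open>A\<close> form a nonempty open
  set \<open>C w\<close>. By mixing, only finitely many \<open>g\<close> separate \<open>C w\<close>
  from the translate of \<open>W U\<close>; since there are finitely many pairs of a word and a
  letter, the infinite set \<open>H\<close> has an element outside \<open>A\<close> avoiding all of
  them.\<close>

lemma exists_independent_extension:
  assumes act: "group_action G (topspace T) \<phi>"
    and cont: "\<forall>g\<in>carrier G. continuous_map T T (\<phi> g)"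
    and mix: "strongly_mixing G T \<phi>"
    and fin: "finite \<U>" and W: "\<forall>U\<in>\<U>. openin T (W U) \<and> W U \<noteq> {}"
    and H: "H \<subseteq> carrier G" "infinite H"
    and A: "finite A" "A \<subseteq> H" "independent_along (topspace T) \<phi> W \<U> A"
  shows "\<exists>g\<in>H - A. independent_along (topspace T) \<phi> W \<U> (insert g A)"
proof -
  define C where "C w = {x \<in> topspace T. \<forall>g\<in>A. \<phi> g x \<in> W (w g)}" for w
  define bad where "bad w U = {g \<in> carrier G. C w \<inter> translate_inv G \<phi> g (W U) = {}}" for w U
  have "openin T (C w)" if "w \<in> A \<rightarrow> \<U>" for w
  proof -
    \<comment> \<open>Intersecting with the whole space takes care of \<open>A = {}\<close>, where
      the inner intersection is \<open>UNIV\<close>.\<close>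
    have "openin T (topspace T \<inter> (\<Inter>g\<in>A. {x \<in> topspace T. \<phi> g x \<in> W (w g)}))"
      using that W H A cont
      by (intro openin_Int_Inter[OF _ openin_topspace])
         (auto intro!: openin_continuous_map_preimage)
    moreover have "topspace T \<inter> (\<Inter>g\<in>A. {x \<in> topspace T. \<phi> g x \<in> W (w g)}) = C w"
      by (auto simp: C_def)
    ultimately show ?thesis by simp
  qed
  moreover have "C w \<noteq> {}" if "w \<in> A \<rightarrow> \<U>" for w
    using bspec[OF A(3)[unfolded independent_along_def] that] by (auto simp: C_def)
  ultimately have "finite (bad w U)" if "w \<in> A \<rightarrow> \<U>" "U \<in> \<U>" for w U
    using mix[unfolded strongly_mixing_def, rule_format, of "C w" "W U"] that bspec[OF W, of U]
    unfolding bad_def by simp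
  \<comment> \<open>Only the values of \<open>w\<close> on \<open>A\<close> affect
    \<open>bad w U\<close>, so the extensional words suffice, and there are finitely many of
    these.\<close>
  then have "finite (A \<union> (\<Union>w\<in>PiE A (\<lambda>_. \<U>). \<Union>U\<in>\<U>. bad w U))"
    using fin A(1) by (intro finite_UnI finite_UN_I finite_PiE) (auto simp: PiE_def)
  then obtain g where g: "g \<in> H" "g \<notin> A \<union> (\<Union>w\<in>PiE A (\<lambda>_. \<U>). \<Union>U\<in>\<U>. bad w U)"
    using H(2) by (meson finite_subset subsetI)
  have "\<exists>x\<in>topspace T. \<forall>h\<in>insert g A. \<phi> h x \<in> W (w h)" if w: "w \<in> insert g A \<rightarrow> \<U>" for w
  proof -
    have "restrict w A \<in> PiE A (\<lambda>_. \<U>)" "w g \<in> \<U>"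
      using w by auto
    then have "g \<notin> bad (restrict w A) (w g)"
      using g(2) by blast
    then have "C (restrict w A) \<inter> translate_inv G \<phi> g (W (w g)) \<noteq> {}"
      using g(1) H(1) unfolding bad_def by blast
    moreover have "translate_inv G \<phi> g (W (w g)) = {x \<in> topspace T. \<phi> g x \<in> W (w g)}"
      using g H W \<open>w g \<in> \<U>\<close> by (intro translate_inv_eq_vimage[OF act]) (auto dest: openin_subset)
    ultimately show ?thesis
      unfolding C_def by auto
  qed
  then show ?thesis
    using g unfolding independent_along_def by blast
qed

text \<open>A word on \<open>A\<close> is extended to \<open>B\<close> by a constant letter
  \<open>U\<close>. Without letters this fails: over an empty space, independence along a nonempty
  \<open>B\<close> is then vacuous, while independence along \<open>{}\<close> asks for a
  point.\<close>

lemma independent_along_subset: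
  assumes B: "independent_along X \<phi> W \<U> B" and sub: "A \<subseteq> B" and ne: "\<U> \<noteq> {}"
  shows "independent_along X \<phi> W \<U> A"
  unfolding independent_along_def
proof
  fix w assume w: "w \<in> A \<rightarrow> \<U>"
  obtain U where "U \<in> \<U>" using ne by blast
  then have w': "(\<lambda>g. if g \<in> A then w g else U) \<in> B \<rightarrow> \<U>"
    using w by auto
  show "\<exists>x\<in>X. \<forall>g\<in>A. \<phi> g x \<in> W (w g)"
    using bspec[OF B[unfolded independent_along_def] w'] sub by fastforce
qed

text \<open>Iterates the one-element extension. Empty \<open>A\<close> is excluded in the conclusion
  because the empty cover of the empty space is allowed: there are then no words on a nonempty
  \<open>A\<close>, but independence along \<open>{}\<close> is false.\<close>

lemma exists_infinite_independent_subset: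
  assumes act: "group_action G (topspace T) \<phi>"
    and cont: "\<forall>g\<in>carrier G. continuous_map T T (\<phi> g)"
    and mix: "strongly_mixing G T \<phi>"
    and fin: "finite \<U>" and W: "\<forall>U\<in>\<U>. openin T (W U) \<and> W U \<noteq> {}"
    and H: "H \<subseteq> carrier G" "infinite H"
  shows "\<exists>S\<subseteq>H. infinite S \<and>
    (\<forall>A\<subseteq>S. finite A \<and> A \<noteq> {} \<longrightarrow> independent_along (topspace T) \<phi> W \<U> A)"
proof (cases "\<U> = {}")
  case True
  then show ?thesis
    using H(2) by (intro exI[of _ H]) (auto simp: independent_along_def)
next
  case False
  \<comment> \<open>The greedy construction starts at \<open>{}\<close>, where independence means
    that the space has a point; any nonempty \<open>W U\<close> supplies one.\<close>
  then obtain U x where "U \<in> \<U>" "x \<in> W U"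
    using W by blast
  then have "x \<in> topspace T"
    using W openin_subset[of T "W U"] by blast
  then have empty: "independent_along (topspace T) \<phi> W \<U> {}"
    by (auto simp: independent_along_def)
  have "\<exists>S\<subseteq>H. infinite S \<and>
      (\<forall>A\<subseteq>S. finite A \<longrightarrow> independent_along (topspace T) \<phi> W \<U> A)"
  proof (rule infinite_set_from_finite_extensions)
    show "\<exists>g\<in>H - A. independent_along (topspace T) \<phi> W \<U> (insert g A)"
      if "finite A" "A \<subseteq> H" "independent_along (topspace T) \<phi> W \<U> A" for A
      by (rule exists_independent_extension[OF act cont mix fin W H that])
    show "independent_along (topspace T) \<phi> W \<U> A"
      if "independent_along (topspace T) \<phi> W \<U> B" "A \<subseteq> B" for A B
      by (rule independent_along_subset[OF that False])
  qed (rule empty)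
  then show ?thesis by metis
qed

section \<open>Covering numbers of joins of translated covers\<close>

lemma min_subcover_card_le:
  assumes "\<V> \<subseteq> \<U>" "finite \<V>" "X \<subseteq> \<Union>\<V>"
  shows "min_subcover_card X \<U> \<le> card \<V>"
  unfolding min_subcover_card_def using assms by (intro Least_le) blast

lemma min_subcover_card_attained:
  assumes "finite \<U>" "X \<subseteq> \<Union>\<U>"
  obtains \<V> where "\<V> \<subseteq> \<U>" "finite \<V>" "X \<subseteq> \<Union>\<V>" "card \<V> = min_subcover_card X \<U>"
proof -
  have "\<exists>\<V>\<subseteq>\<U>. finite \<V> \<and> card \<V> = min_subcover_card X \<U> \<and> X \<subseteq> \<Union>\<V>"
    unfolding min_subcover_card_def
    by (rule LeastI[where P = "\<lambda>n. \<exists>\<V>\<subseteq>\<U>. finite \<V> \<and> card \<V> = n \<and> X \<subseteq> \<Union>\<V>" and k = "card \<U>"])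
       (use assms in blast)
  then show ?thesis using that by blast
qed

text \<open>Indexing the cells by extensional words exhibits the join as an image of a finite set.
  Distinct words may give the same cell, so counting words bounds the number of cells only from
  above.\<close>

lemma cover_join_translates_eq:
  "cover_join X A (\<lambda>g. translate_inv G \<phi> g ` \<U>) =
     (\<lambda>w. X \<inter> (\<Inter>g\<in>A. translate_inv G \<phi> g (w g))) ` PiE A (\<lambda>_. \<U>)"
proof (intro subset_antisym subsetI)
  fix B assume "B \<in> cover_join X A (\<lambda>g. translate_inv G \<phi> g ` \<U>)"
  then obtain f where f: "B = X \<inter> (\<Inter>g\<in>A. f g)" "\<forall>g\<in>A. f g \<in> translate_inv G \<phi> g ` \<U>"
    unfolding cover_join_def by blast
  then have "\<forall>g\<in>A. \<exists>U. U \<in> \<U> \<and> f g = translate_inv G \<phi> g U"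
    by blast
  from bchoice[OF this] obtain w where w: "\<forall>g\<in>A. w g \<in> \<U> \<and> f g = translate_inv G \<phi> g (w g)"
    by blast
  have "B = X \<inter> (\<Inter>g\<in>A. translate_inv G \<phi> g (restrict w A g))"
    using f(1) w by auto
  moreover have "restrict w A \<in> PiE A (\<lambda>_. \<U>)"
    using w by auto
  ultimately show "B \<in> (\<lambda>w. X \<inter> (\<Inter>g\<in>A. translate_inv G \<phi> g (w g))) ` PiE A (\<lambda>_. \<U>)"
    by blast
next
  fix B assume "B \<in> (\<lambda>w. X \<inter> (\<Inter>g\<in>A. translate_inv G \<phi> g (w g))) ` PiE A (\<lambda>_. \<U>)"
  then obtain w where "B = X \<inter> (\<Inter>g\<in>A. translate_inv G \<phi> g (w g))" "w \<in> PiE A (\<lambda>_. \<U>)"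
    by blast
  then show "B \<in> cover_join X A (\<lambda>g. translate_inv G \<phi> g ` \<U>)"
    unfolding cover_join_def by (auto intro!: exI[of _ "\<lambda>g. translate_inv G \<phi> g (w g)"])
qed

text \<open>A point lies in the cell of its itinerary: for each \<open>g\<close> in
  \<open>A\<close>, choose a member of the cover containing \<open>\<phi> g x\<close>.\<close>

lemma cover_join_translates_covers:
  assumes act: "group_action G X \<phi>" and A: "A \<subseteq> carrier G" and cover: "\<Union>\<U> = X"
  shows "X \<subseteq> \<Union>(cover_join X A (\<lambda>g. translate_inv G \<phi> g ` \<U>))"
proof
  fix x assume x: "x \<in> X"
  have "\<forall>g\<in>A. \<exists>U\<in>\<U>. x \<in> translate_inv G \<phi> g U"
  proof
    fix g assume g: "g \<in> A"
    then have "\<phi> g x \<in> X"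
      using group_action.element_image[OF act] A x by blast
    then obtain U where "U \<in> \<U>" "\<phi> g x \<in> U"
      using cover by blast
    moreover have "translate_inv G \<phi> g U = {x \<in> X. \<phi> g x \<in> U}"
      using g A \<open>U \<in> \<U>\<close> cover by (intro translate_inv_eq_vimage[OF act]) auto
    ultimately show "\<exists>U\<in>\<U>. x \<in> translate_inv G \<phi> g U"
      using x by blast
  qed
  then obtain w where "\<forall>g\<in>A. w g \<in> \<U> \<and> x \<in> translate_inv G \<phi> g (w g)"
    by metis
  then show "x \<in> \<Union>(cover_join X A (\<lambda>g. translate_inv G \<phi> g ` \<U>))"
    using x unfolding cover_join_translates_eq
    by (intro UnionI[OF imageI[of "restrict w A"]]) auto
qed

lemma min_subcover_card_join_le:
  assumes act: "group_action G X \<phi>" and A: "A \<subseteq> carrier G" "finite A"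
    and cover: "\<Union>\<U> = X" "finite \<U>"
  shows "min_subcover_card X (cover_join X A (\<lambda>g. translate_inv G \<phi> g ` \<U>)) \<le> card \<U> ^ card A"
proof -
  let ?J = "cover_join X A (\<lambda>g. translate_inv G \<phi> g ` \<U>)"
  have fin: "finite (PiE A (\<lambda>_. \<U>))"
    using A cover by (intro finite_PiE)
  \<comment> \<open>The whole join is used as the subcover.\<close>
  have "min_subcover_card X ?J \<le> card ?J"
    using fin cover_join_translates_covers[OF act A(1) cover(1)]
    by (intro min_subcover_card_le) (simp_all add: cover_join_translates_eq)
  also have "\<dots> \<le> card (PiE A (\<lambda>_. \<U>))"
    unfolding cover_join_translates_eq by (rule card_image_le[OF fin])
  also have "\<dots> = card \<U> ^ card A"
    using A by (simp add: card_PiE)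
  finally show ?thesis .
qed

text \<open>Sorts the words by the cells of an optimal subcover that contain their realising points.
  The estimate stays multiplicative in \<open>nat\<close>; logarithms are taken only for the
  entropy.\<close>

lemma independent_along_join_lower_bound:
  assumes act: "group_action G X \<phi>" and A: "A \<subseteq> carrier G" "finite A"
    and cover: "\<Union>\<U> = X" "finite \<U>"
    and indep: "independent_along X \<phi> W \<U> A"
    and meets: "\<forall>V\<in>\<U>. card {U \<in> \<U>. W U \<inter> V \<noteq> {}} \<le> c"
  shows "card \<U> ^ card A \<le>
    c ^ card A * min_subcover_card X (cover_join X A (\<lambda>g. translate_inv G \<phi> g ` \<U>))"
proof -
  let ?J = "cover_join X A (\<lambda>g. translate_inv G \<phi> g ` \<U>)"
  have fin: "finite (PiE A (\<lambda>_. \<U>))"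
    using A cover by (intro finite_PiE)
  then have "finite ?J"
    by (simp add: cover_join_translates_eq)
  then obtain \<V> where \<V>: "\<V> \<subseteq> ?J" "finite \<V>" "X \<subseteq> \<Union>\<V>"
      "card \<V> = min_subcover_card X ?J"
    using cover_join_translates_covers[OF act A(1) cover(1)]
    by (rule min_subcover_card_attained)
  have "\<forall>w\<in>PiE A (\<lambda>_. \<U>). \<exists>x\<in>X. \<forall>g\<in>A. \<phi> g x \<in> W (w g)"
    using indep unfolding independent_along_def PiE_def by simp
  \<comment> \<open>Words are counted below, not points, so it does not matter whether
    \<open>p\<close> is injective.\<close>
  then obtain p where p: "\<And>w. w \<in> PiE A (\<lambda>_. \<U>) \<Longrightarrow> p w \<in> X"
      "\<And>w g. w \<in> PiE A (\<lambda>_. \<U>) \<Longrightarrow> g \<in> A \<Longrightarrow> \<phi> g (p w) \<in> W (w g)"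
    by metis
  have "card {w \<in> PiE A (\<lambda>_. \<U>). p w \<in> B} \<le> c ^ card A" if "B \<in> \<V>" for B
  proof -
    obtain u where u: "u \<in> PiE A (\<lambda>_. \<U>)" "B = X \<inter> (\<Inter>g\<in>A. translate_inv G \<phi> g (u g))"
      using \<open>B \<in> \<V>\<close> \<V>(1) unfolding cover_join_translates_eq by blast
    \<comment> \<open>If \<open>p w\<close> lies in the cell of \<open>u\<close>, then
      \<open>\<phi> g (p w)\<close> lies in both \<open>W (w g)\<close> and \<open>u g\<close>. This
      leaves at most \<open>c\<close> choices for each letter \<open>w g\<close>.\<close>
    let ?P = "PiE A (\<lambda>g. {U \<in> \<U>. W U \<inter> u g \<noteq> {}})"
    have "w \<in> ?P" if w: "w \<in> PiE A (\<lambda>_. \<U>)" "p w \<in> B" for w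
    proof (rule PiE_I)
      fix g assume g: "g \<in> A"
      then have "translate_inv G \<phi> g (u g) = {x \<in> X. \<phi> g x \<in> u g}"
        using A(1) u(1) cover by (intro translate_inv_eq_vimage[OF act]) auto
      then have "\<phi> g (p w) \<in> u g"
        using w(2) g u(2) by auto
      then show "w g \<in> {U \<in> \<U>. W U \<inter> u g \<noteq> {}}"
        using p(2)[OF w(1) g] w(1) g by auto
    qed (use w in auto)
    then have "card {w \<in> PiE A (\<lambda>_. \<U>). p w \<in> B} \<le> card ?P"
      using A cover by (intro card_mono finite_PiE) auto
    also have "\<dots> = (\<Prod>g\<in>A. card {U \<in> \<U>. W U \<inter> u g \<noteq> {}})"
      using A by (simp add: card_PiE)
    also have "\<dots> \<le> (\<Prod>g\<in>A. c)"
      using u(1) meets by (intro prod_mono) auto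
    finally show ?thesis by simp
  qed
  note fibre = this
  have "card \<U> ^ card A = card (PiE A (\<lambda>_. \<U>))"
    using A by (simp add: card_PiE)
  also have "\<dots> \<le> card (\<Union>B\<in>\<V>. {w \<in> PiE A (\<lambda>_. \<U>). p w \<in> B})"
    using subsetD[OF \<V>(3) p(1)] \<V>(2) fin by (intro card_mono) auto
  also have "\<dots> \<le> (\<Sum>B\<in>\<V>. card {w \<in> PiE A (\<lambda>_. \<U>). p w \<in> B})"
    by (rule card_UN_le[OF \<V>(2)])
  also have "\<dots> \<le> (\<Sum>B\<in>\<V>. c ^ card A)"
    by (rule sum_mono[OF fibre])
  finally show ?thesis
    by (simp add: \<V>(4) mult.commute)
qed

section \<open>Folner sets and subcovers of admissible covers\<close>

lemma Folner_sequence_eventually_meets: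
  assumes F: "Folner_sequence G F" and S: "S \<subseteq> carrier G" "S \<noteq> {}"
  shows "\<forall>\<^sub>F n in sequentially. finite (S \<inter> F n) \<and> S \<inter> F n \<noteq> {}"
proof -
  \<comment> \<open>The sets exhaust the group, so some \<open>F m\<close> contains a point of
    \<open>S\<close>; by monotonicity so do all later ones. The bound \<open>m \<ge> 1\<close> keeps
    clear of the unconstrained \<open>F 0\<close>.\<close>
  obtain s m where s: "s \<in> S" "s \<in> F m" "m \<ge> 1"
    using F S unfolding Folner_sequence_def by blast
  have "F m \<subseteq> F n" if "n \<ge> m" for n
    using that
  proof (induction rule: dec_induct)
    case (step n)
    then show ?case
      using F s(3) unfolding Folner_sequence_def by (meson le_trans subset_trans)
  qed simp
  moreover have "finite (F n)" if "n \<ge> m" for n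
    using F s(3) that unfolding Folner_sequence_def asymptotically_invariant_def by auto
  ultimately show ?thesis
    using s unfolding eventually_sequentially by blast
qed

text \<open>An omitted member would be covered by the others, leaving nothing in the part that
  belongs to it alone, whereas admissibility gives that part nonempty interior.\<close>

lemma admissible_open_cover_subcover_eq:
  assumes adm: "admissible_open_cover T \<U>" and \<V>: "\<V> \<subseteq> \<U>" "topspace T \<subseteq> \<Union>\<V>"
  shows "\<V> = \<U>"
proof (rule ccontr)
  assume "\<V> \<noteq> \<U>"
  then obtain U where U: "U \<in> \<U>" "U \<notin> \<V>"
    using \<V> by blast
  then have "U \<subseteq> \<Union>(\<U> - {U})"
    using adm \<V> unfolding admissible_open_cover_def open_cover_def by blast
  then have "U - \<Union>(\<U> - {U}) = {}"
    by blast
  then show False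
    using adm U(1) unfolding admissible_open_cover_def by (metis interior_of_empty)
qed

text \<open>Compactness provides a finite subcover, and the only subcover is the cover
  itself.\<close>

lemma admissible_open_cover_finite:
  assumes comp: "compact_space T" and adm: "admissible_open_cover T \<U>"
  shows "finite \<U>"
proof -
  have "\<forall>U\<in>\<U>. openin T U" "topspace T \<subseteq> \<Union>\<U>"
    using adm unfolding admissible_open_cover_def open_cover_def by auto
  then obtain \<V> where "finite \<V>" "\<V> \<subseteq> \<U>" "topspace T \<subseteq> \<Union>\<V>"
    using comp unfolding compact_space_alt by meson
  then show ?thesis
    using admissible_open_cover_subcover_eq[OF adm] by metis
qed

lemma min_subcover_card_admissible:
  assumes adm: "admissible_open_cover T \<U>" and fin: "finite \<U>"
  shows "min_subcover_card (topspace T) \<U> = card \<U>"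
proof -
  have "topspace T \<subseteq> \<Union>\<U>"
    using adm unfolding admissible_open_cover_def open_cover_def by auto
  with fin obtain \<V> where "\<V> \<subseteq> \<U>" "topspace T \<subseteq> \<Union>\<V>"
      "card \<V> = min_subcover_card (topspace T) \<U>"
    by (rule min_subcover_card_attained)
  then show ?thesis
    using admissible_open_cover_subcover_eq[OF adm] by metis
qed

section \<open>Entropy along the constructed infinite set\<close>

lemma strongly_mixing_admissible_entropy:
  assumes F: "Folner_sequence G F" and comp: "compact_space T"
    and act: "group_action G (topspace T) \<phi>"
    and cont: "\<forall>g\<in>carrier G. continuous_map T T (\<phi> g)"
    and mix: "strongly_mixing G T \<phi>"
    and adm: "admissible_open_cover T \<U>" and H: "H \<subseteq> carrier G" "infinite H"
  shows "\<exists>S\<subseteq>H. infinite S \<and>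
    seq_top_entropy G (topspace T) \<phi> F S \<U> = ereal (ln (real (min_subcover_card (topspace T) \<U>)))"
proof -
  have fin: "finite \<U>"
    by (rule admissible_open_cover_finite[OF comp adm])
  have cover: "\<Union>\<U> = topspace T"
    using adm unfolding admissible_open_cover_def open_cover_def by auto
  define W where "W U = T interior_of (U - \<Union>(\<U> - {U}))" for U
  have W: "\<forall>U\<in>\<U>. openin T (W U) \<and> W U \<noteq> {}"
    using adm unfolding W_def admissible_open_cover_def by auto
  obtain S where S: "S \<subseteq> H" "infinite S"
      and indep: "\<forall>A\<subseteq>S. finite A \<and> A \<noteq> {} \<longrightarrow> independent_along (topspace T) \<phi> W \<U> A"
    using exists_infinite_independent_subset[OF act cont mix fin W H] by blast
  have meets: "\<forall>V\<in>\<U>. card {U \<in> \<U>. W U \<inter> V \<noteq> {}} \<le> 1"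
  proof
    fix V assume "V \<in> \<U>"
    \<comment> \<open>\<open>W U\<close> is contained in \<open>U\<close> and avoids every other
      member.\<close>
    have "{U \<in> \<U>. W U \<inter> V \<noteq> {}} \<subseteq> {V}"
    proof
      fix U assume "U \<in> {U \<in> \<U>. W U \<inter> V \<noteq> {}}"
      then show "U \<in> {V}"
        using \<open>V \<in> \<U>\<close> interior_of_subset[of T "U - \<Union>(\<U> - {U})"] unfolding W_def by blast
    qed
    then show "card {U \<in> \<U>. W U \<inter> V \<noteq> {}} \<le> 1"
      using card_mono[of "{V}"] by simp
  qed
  \<comment> \<open>With \<open>c = 1\<close> the lower bound equals the trivial upper bound, so the
    covering number is exactly \<open>card \<U> ^ card A\<close>.\<close>
  have term_eq: "1 / real (card A) * ln (real (min_subcover_card (topspace T)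
        (cover_join (topspace T) A (\<lambda>g. translate_inv G \<phi> g ` \<U>)))) = ln (real (card \<U>))"
    if A: "A \<subseteq> S" "finite A" "A \<noteq> {}" for A
  proof -
    have indep_A: "independent_along (topspace T) \<phi> W \<U> A"
      using indep A by blast
    have "A \<subseteq> carrier G"
      using A S H by blast
    then have "min_subcover_card (topspace T)
        (cover_join (topspace T) A (\<lambda>g. translate_inv G \<phi> g ` \<U>)) = card \<U> ^ card A"
      using min_subcover_card_join_le[OF act _ A(2) cover fin]
        independent_along_join_lower_bound[OF act _ A(2) cover fin indep_A meets]
      by (intro antisym) auto
    \<comment> \<open>The case \<open>card \<U> = 0\<close> is that of the empty space; both sides
      vanish there because \<open>ln 0 = 0\<close>.\<close>
    then show ?thesis
      using A by (cases "card \<U> = 0") (simp_all add: ln_realpow)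
  qed
  have "S \<subseteq> carrier G" "S \<noteq> {}"
    using S H by auto
  note ev = Folner_sequence_eventually_meets[OF F this]
  have "seq_top_entropy G (topspace T) \<phi> F S \<U> = limsup (\<lambda>n. ereal (ln (real (card \<U>))))"
    unfolding seq_top_entropy_def
    by (intro Limsup_eq eventually_mono[OF ev])
       (elim conjE, intro arg_cong[where f = ereal] term_eq[OF Int_lower1])
  then show ?thesis
    using S by (intro exI[of _ S]) (simp add: Limsup_const min_subcover_card_admissible[OF adm fin])
qed

text \<open>Every quotient over a finite nonempty \<open>A \<subseteq> S\<close> is at least
  log(k/(k-1)) with \<open>k = card \<U>\<close>, a positive bound independent of \<open>A\<close>,
  and it survives the limit superior.\<close>

lemma strongly_mixing_nontrivial_entropy_pos:
  assumes F: "Folner_sequence G F"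
    and act: "group_action G (topspace T) \<phi>"
    and cont: "\<forall>g\<in>carrier G. continuous_map T T (\<phi> g)"
    and mix: "strongly_mixing G T \<phi>"
    and nt: "nontrivial_finite_open_cover T \<U>" and H: "H \<subseteq> carrier G" "infinite H"
  shows "\<exists>S\<subseteq>H. infinite S \<and> seq_top_entropy G (topspace T) \<phi> F S \<U> > 0"
proof -
  have fin: "finite \<U>" and ne: "\<U> \<noteq> {}" and cover: "\<Union>\<U> = topspace T"
    and nd: "\<And>U. U \<in> \<U> \<Longrightarrow> T closure_of U \<noteq> topspace T"
    using nt unfolding nontrivial_finite_open_cover_def open_cover_def by auto
  define k where "k = card \<U>"
  have "k > 0"
    using fin ne by (simp add: k_def card_gt_0_iff)
  \<comment> \<open>A one-member cover consists of the whole space, which is dense. Having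
    \<open>k > 1\<close> keeps \<open>k - 1\<close> positive, as its logarithm requires.\<close>
  moreover have "k \<noteq> 1"
  proof
    assume "k = 1"
    then obtain U where "\<U> = {U}"
      unfolding k_def by (rule card_1_singletonE)
    then have "U \<in> \<U>" "U = topspace T"
      using cover by auto
    then show False
      using nd[of U] closure_of_topspace[of T] by metis
  qed
  ultimately have k: "k > 1" by simp
  define W where "W U = topspace T - T closure_of U" for U
  have W: "\<forall>U\<in>\<U>. openin T (W U) \<and> W U \<noteq> {}"
    using nd closure_of_subset_topspace unfolding W_def by (metis Diff_eq_empty_iff antisym
        closedin_closure_of openin_diff openin_topspace)
  obtain S where S: "S \<subseteq> H" "infinite S"
      and indep: "\<forall>A\<subseteq>S. finite A \<and> A \<noteq> {} \<longrightarrow> independent_along (topspace T) \<phi> W \<U> A"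
    using exists_infinite_independent_subset[OF act cont mix fin W H] by blast
  have meets: "\<forall>V\<in>\<U>. card {U \<in> \<U>. W U \<inter> V \<noteq> {}} \<le> k - 1"
  proof
    fix V assume "V \<in> \<U>"
    have "V \<subseteq> T closure_of V"
      using \<open>V \<in> \<U>\<close> cover by (intro closure_of_subset) auto
    \<comment> \<open>Each member lies in its own closure and hence misses its own
      \<open>W V\<close>; this saves one letter out of \<open>k\<close>.\<close>
    then have "{U \<in> \<U>. W U \<inter> V \<noteq> {}} \<subseteq> \<U> - {V}"
      unfolding W_def by auto
    then have "card {U \<in> \<U>. W U \<inter> V \<noteq> {}} \<le> card (\<U> - {V})"
      using fin by (intro card_mono) auto
    then show "card {U \<in> \<U>. W U \<inter> V \<noteq> {}} \<le> k - 1"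
      using \<open>V \<in> \<U>\<close> by (simp add: k_def)
  qed
  define \<delta> where "\<delta> = ln (real k) - ln (real (k - 1))"
  have \<delta>: "\<delta> > 0"
    using k by (simp add: \<delta>_def)
  have term_ge: "1 / real (card A) * ln (real (min_subcover_card (topspace T)
        (cover_join (topspace T) A (\<lambda>g. translate_inv G \<phi> g ` \<U>)))) \<ge> \<delta>"
    if A: "A \<subseteq> S" "finite A" "A \<noteq> {}" for A
  proof -
    define N where "N = min_subcover_card (topspace T)
        (cover_join (topspace T) A (\<lambda>g. translate_inv G \<phi> g ` \<U>))"
    have indep_A: "independent_along (topspace T) \<phi> W \<U> A"
      using indep A by blast
    have "A \<subseteq> carrier G"
      using A S H by blast
    then have le: "k ^ card A \<le> (k - 1) ^ card A * N"
      using independent_along_join_lower_bound[OF act _ A(2) cover fin indep_A meets]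
      by (simp add: N_def k_def)
    have m: "card A > 0"
      using A by (simp add: card_gt_0_iff)
    \<comment> \<open>For \<open>N = 0\<close> the inequality \<open>le\<close> would make a power
      of \<open>k\<close> vanish. Positivity is needed to split the logarithm of the
      product.\<close>
    have "N > 0"
      using le k by (cases "N = 0") auto
    have "real (k ^ card A) \<le> real ((k - 1) ^ card A * N)"
      using le by (simp only: of_nat_le_iff)
    then have "ln (real k ^ card A) \<le> ln (real (k - 1) ^ card A * real N)"
      using k \<open>N > 0\<close> by (subst ln_le_cancel_iff) auto
    also have "\<dots> = ln (real (k - 1) ^ card A) + ln (real N)"
      using k \<open>N > 0\<close> by (intro ln_mult_pos) auto
    finally have "real (card A) * ln (real k) \<le> real (card A) * ln (real (k - 1)) + ln (real N)"
      using k by (simp add: ln_realpow)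
    then have "\<delta> * real (card A) \<le> ln (real N)"
      by (simp add: \<delta>_def algebra_simps)
    then show ?thesis
      using m by (simp add: N_def[symmetric] pos_le_divide_eq)
  qed
  have "S \<subseteq> carrier G" "S \<noteq> {}"
    using S H by auto
  note ev = Folner_sequence_eventually_meets[OF F this]
  have "limsup (\<lambda>n. ereal \<delta>) \<le> seq_top_entropy G (topspace T) \<phi> F S \<U>"
    unfolding seq_top_entropy_def
    by (intro Limsup_mono eventually_mono[OF ev])
       (elim conjE, simp only: ereal_less_eq, rule term_ge[OF Int_lower1])
  then have "ereal \<delta> \<le> seq_top_entropy G (topspace T) \<phi> F S \<U>"
    by (simp add: Limsup_const)
  then have "0 < seq_top_entropy G (topspace T) \<phi> F S \<U>"
    using \<delta> by (meson ereal_less(2) less_le_trans)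
  then show ?thesis
    using S by blast
qed

theorem theorem4p3:
  fixes G :: "('g, 'b) monoid_scheme"
    and F :: "nat \<Rightarrow> 'g set"
    and X :: "'x set"
    and d :: "'x \<Rightarrow> 'x \<Rightarrow> real"
    and \<phi> :: "'g \<Rightarrow> 'x \<Rightarrow> 'x"
  assumes "group G" and "infinite (carrier G)" and "countable (carrier G)"
    and "amenable_group G"
    and "Folner_sequence G F"
    and "G_system G X d \<phi>"
    and "strongly_mixing G (Metric_space.mtopology X d) \<phi>"
  shows "(\<forall>\<U> H. admissible_open_cover (Metric_space.mtopology X d) \<U> \<and>
             H \<subseteq> carrier G \<and> infinite H \<longrightarrow>
             (\<exists>S\<subseteq>H. infinite S \<and>
                seq_top_entropy G X \<phi> F S \<U> = ereal (ln (real (min_subcover_card X \<U>))))) \<and>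
         (\<forall>\<U> H. nontrivial_finite_open_cover (Metric_space.mtopology X d) \<U> \<and>
             H \<subseteq> carrier G \<and> infinite H \<longrightarrow>
             (\<exists>S\<subseteq>H. infinite S \<and> seq_top_entropy G X \<phi> F S \<U> > 0))"
proof -
  let ?T = "Metric_space.mtopology X d"
  have sys: "Metric_space X d" "compact_space ?T" "group_action G X \<phi>"
      "\<forall>g\<in>carrier G. continuous_map ?T ?T (\<phi> g)"
    using assms(6) unfolding G_system_def by auto
  have top: "topspace ?T = X"
    by (rule Metric_space.topspace_mtopology[OF sys(1)])
  note adm = strongly_mixing_admissible_entropy
    [of G F ?T \<phi>, unfolded top, OF assms(5) sys(2,3,4) assms(7)]
  note nt = strongly_mixing_nontrivial_entropy_pos
    [of G F ?T \<phi>, unfolded top, OF assms(5) sys(3,4) assms(7)]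
  show ?thesis
    using adm nt by blast
qed

end
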